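(* Let $$G=\langle a,b,t\mid a^3=b^3=t^2=e,\ ab=ba,\ tat=a^2,\ tbt=b^2\rangle$$ and let $A=\{e,a,t,bt\}$. Then $$i\bigl(\operatorname{Cay}(G,\partial A)\bigr)=2\qquad\text{and}\qquad \alpha\bigl(\operatorname{Cay}(G,\partial A)\bigr)=4 .$$
   Context: For a non-empty subset $A$ of a group $G$ with identity $e$, $\partial A=A^{-1}A\setminus\{e\}$, where $A^{-1}A=\{x^{-1}y\mid x,y\in A\}$. For a subset $S\subseteq G$ with $e\notin S$ and $S=S^{-1}$, the (left) Cayley graph $\operatorname{Cay}(G,S)$ is the simple graph with vertex set $G$ in which $u,v$ are adjacent if and only if $vu^{-1}\in S$. For a finite graph $\Gamma$, $\alpha(\Gamma)$ is the size of a largest independent set and $i(\Gamma)$ is the size of a smallest maximal (with respect to inclusion) independent set. *)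

theory Defs
  imports "HOL-Algebra.Algebra" "HOL-Library.Ramsey"
begin

section \<open>Groups given by generators and relations\<close>

datatype 'x letter = Gen 'x | Inv 'x

type_synonym 'x word = "'x letter list"

fun inv_letter :: "'x letter \<Rightarrow> 'x letter" where
  "inv_letter (Gen x) = Inv x"
| "inv_letter (Inv x) = Gen x"

definition inv_word :: "'x word \<Rightarrow> 'x word" where
  "inv_word w = rev (map inv_letter w)"

text \<open>A pair \<open>(l, r) \<in> R\<close> stands for the defining relation \<open>l = r\<close>. The generators are all
  elements of the type \<open>'x\<close>. The predicate below is the least congruence on words that contains
  free cancellation and the relations in \<open>R\<close>.\<close>

inductive pres_eq :: "('x word \<times> 'x word) set \<Rightarrow> 'x word \<Rightarrow> 'x word \<Rightarrow> bool"
  for R :: "('x word \<times> 'x word) set" where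
  refl: "pres_eq R w w"
| sym: "pres_eq R u v \<Longrightarrow> pres_eq R v u"
| trans: "pres_eq R u v \<Longrightarrow> pres_eq R v w \<Longrightarrow> pres_eq R u w"
| cancel: "pres_eq R (p @ [x, inv_letter x] @ q) (p @ q)"
| rel: "(l, r) \<in> R \<Longrightarrow> pres_eq R (p @ l @ q) (p @ r @ q)"

definition pres_rel :: "('x word \<times> 'x word) set \<Rightarrow> ('x word \<times> 'x word) set" where
  "pres_rel R = {(u, v). pres_eq R u v}"

definition word_class :: "('x word \<times> 'x word) set \<Rightarrow> 'x word \<Rightarrow> 'x word set" where
  "word_class R w = pres_rel R `` {w}"

definition presented_group :: "('x word \<times> 'x word) set \<Rightarrow> 'x word set monoid" where
  "presented_group R =
     \<lparr> carrier = UNIV // pres_rel R,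
       monoid.mult = (\<lambda>P Q. \<Union>u\<in>P. \<Union>v\<in>Q. word_class R (u @ v)),
       one = word_class R [] \<rparr>"

definition pres_gen :: "('x word \<times> 'x word) set \<Rightarrow> 'x \<Rightarrow> 'x word set" where
  "pres_gen R x = word_class R [Gen x]"

lemma equiv_pres_rel: "equiv UNIV (pres_rel R)"
proof (rule equivI)
  show "refl_on UNIV (pres_rel R)"
    by (rule refl_onI) (auto simp: pres_rel_def intro: pres_eq.refl)
  show "sym (pres_rel R)"
    by (rule symI) (auto simp: pres_rel_def intro: pres_eq.sym)
  show "trans (pres_rel R)"
    by (rule transI) (auto simp: pres_rel_def intro: pres_eq.trans)
qed simp

lemma word_class_eq_iff: "word_class R u = word_class R v \<longleftrightarrow> pres_eq R u v"
  unfolding word_class_def using eq_equiv_class_iff[OF equiv_pres_rel, of u v R]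
  by (simp add: pres_rel_def)

lemma in_word_class_iff: "v \<in> word_class R u \<longleftrightarrow> pres_eq R u v"
  by (simp add: word_class_def pres_rel_def)

lemma pres_eq_context: "pres_eq R u v \<Longrightarrow> pres_eq R (p @ u @ q) (p @ v @ q)"
proof (induction rule: pres_eq.induct)
  case (cancel p' x q')
  show ?case using pres_eq.cancel[of R "p @ p'" x "q' @ q"] by simp
next
  case (rel l r p' q')
  then show ?case using pres_eq.rel[of l r R "p @ p'" "q' @ q"] by simp
qed (blast intro: pres_eq.refl pres_eq.sym pres_eq.trans)+

lemma pres_eq_append: "pres_eq R u u' \<Longrightarrow> pres_eq R v v' \<Longrightarrow> pres_eq R (u @ v) (u' @ v')"
  using pres_eq_context[of R u u' "[]" v] pres_eq_context[of R v v' u' "[]"]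
  by (auto intro: pres_eq.trans)

lemma carrier_presented_group: "carrier (presented_group R) = range (word_class R)"
  by (auto simp: presented_group_def quotient_def word_class_def)

lemma mult_presented_group:
  "word_class R u \<otimes>\<^bsub>presented_group R\<^esub> word_class R v = word_class R (u @ v)"
proof -
  have "word_class R (u' @ v') = word_class R (u @ v)"
    if "u' \<in> word_class R u" "v' \<in> word_class R v" for u' v'
    using that pres_eq.sym[OF pres_eq_append, of R u u' v v']
    by (simp add: in_word_class_iff word_class_eq_iff)
  moreover have "u \<in> word_class R u" "v \<in> word_class R v"
    by (simp_all add: in_word_class_iff pres_eq.refl)
  ultimately have "(\<Union>u'\<in>word_class R u. \<Union>v'\<in>word_class R v. word_class R (u' @ v'))
      = word_class R (u @ v)"
    by blast
  then show ?thesis by (simp add: presented_group_def)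
qed

lemma one_presented_group: "\<one>\<^bsub>presented_group R\<^esub> = word_class R []"
  by (simp add: presented_group_def)

lemma inv_letter_inv_letter [simp]: "inv_letter (inv_letter x) = x"
  by (cases x) auto

lemma pres_eq_inv_word: "pres_eq R (inv_word w @ w) []"
proof (induction w)
  case Nil
  show ?case by (simp add: inv_word_def pres_eq.refl)
next
  case (Cons x w)
  have "pres_eq R (inv_word (x # w) @ x # w) (inv_word w @ w)"
    using pres_eq.cancel[of R "inv_word w" "inv_letter x" w] by (simp add: inv_word_def)
  then show ?case using Cons by (rule pres_eq.trans)
qed

lemma group_presented_group: "group (presented_group R)"
proof (rule groupI)
  fix P assume "P \<in> carrier (presented_group R)"
  then obtain w where "P = word_class R w" by (auto simp: carrier_presented_group)
  then show "\<exists>Q\<in>carrier (presented_group R). Q \<otimes>\<^bsub>presented_group R\<^esub> P = \<one>\<^bsub>presented_group R\<^esub>"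
    by (intro bexI[of _ "word_class R (inv_word w)"])
      (auto simp: carrier_presented_group mult_presented_group one_presented_group
        word_class_eq_iff pres_eq_inv_word)
qed (auto simp: carrier_presented_group mult_presented_group one_presented_group)


section \<open>Difference sets and Cayley graphs\<close>

definition difference_set :: "('a, 'm) monoid_scheme \<Rightarrow> 'a set \<Rightarrow> 'a set" where
  "difference_set G A = (set_inv\<^bsub>G\<^esub> A <#>\<^bsub>G\<^esub> A) - {\<one>\<^bsub>G\<^esub>}"

text \<open>A simple graph is a pair of a vertex set and a set of two-element edges.\<close>

type_synonym 'a ugraph = "'a set \<times> 'a set set"

text \<open>Used for \<open>\<one> \<notin> S\<close> and \<open>S\<close> closed under inverses only, so that all edges have two elements and
  the adjacency condition is symmetric in \<open>u\<close> and \<open>v\<close>.\<close>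

definition cayley_graph :: "('a, 'm) monoid_scheme \<Rightarrow> 'a set \<Rightarrow> 'a ugraph" where
  "cayley_graph G S =
     (carrier G,
      {{u, v} | u v. u \<in> carrier G \<and> v \<in> carrier G \<and> v \<otimes>\<^bsub>G\<^esub> inv\<^bsub>G\<^esub> u \<in> S})"

lemma one_notin_difference_set: "\<one>\<^bsub>G\<^esub> \<notin> difference_set G A"
  by (simp add: difference_set_def)

lemma (in group) set_inv_difference_set:
  assumes "A \<subseteq> carrier G"
  shows "set_inv (difference_set G A) = difference_set G A"
proof -
  have inv_in: "inv s \<in> difference_set G A" if s: "s \<in> difference_set G A" for s
  proof -
    obtain x y where xy: "x \<in> A" "y \<in> A" "s = inv x \<otimes> y" "s \<noteq> \<one>"
      using s by (auto simp: difference_set_def set_mult_def SET_INV_def)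
    then have "x \<in> carrier G" "y \<in> carrier G" using assms by auto
    then have "inv s = inv y \<otimes> x" "inv s \<noteq> \<one>"
      using xy(3,4) by (simp add: inv_mult_group, metis inv_closed inv_eq_1_iff m_closed)
    then show ?thesis using xy by (auto simp: difference_set_def set_mult_def SET_INV_def)
  qed
  have "s \<in> carrier G" if "s \<in> difference_set G A" for s
    using that assms by (auto simp: difference_set_def set_mult_def SET_INV_def)
  then have "s \<in> set_inv (difference_set G A)" if "s \<in> difference_set G A" for s
    using inv_in[OF that] inv_inv[of s] that unfolding SET_INV_def by (metis UN_iff singletonI)
  then show ?thesis
    using inv_in by (auto simp: SET_INV_def)
qed


section \<open>Independent sets\<close>

definition independent_set :: "'a ugraph \<Rightarrow> 'a set \<Rightarrow> bool" where
  "independent_set \<Gamma> I \<longleftrightarrow> I \<subseteq> fst \<Gamma> \<and> indep I (snd \<Gamma>)"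

definition maximal_independent_set :: "'a ugraph \<Rightarrow> 'a set \<Rightarrow> bool" where
  "maximal_independent_set \<Gamma> I \<longleftrightarrow>
     independent_set \<Gamma> I \<and> (\<forall>J. independent_set \<Gamma> J \<and> I \<subseteq> J \<longrightarrow> J = I)"

text \<open>Both numbers are meant for finite graphs only.\<close>

definition independence_number :: "'a ugraph \<Rightarrow> nat" where
  "independence_number \<Gamma> = Max {card I | I. independent_set \<Gamma> I}"

definition independent_domination_number :: "'a ugraph \<Rightarrow> nat" where
  "independent_domination_number \<Gamma> = Min {card I | I. maximal_independent_set \<Gamma> I}"


section \<open>A group of order 18\<close>

datatype gens = Ga | Gb | Gt

text \<open>The relations are \<open>a\<^sup>3 = b\<^sup>3 = t\<^sup>2 = e\<close>, \<open>ab = ba\<close>, \<open>tat = a\<^sup>2\<close>, \<open>tbt = b\<^sup>2\<close>.\<close>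

definition rels :: "(gens word \<times> gens word) set" where
  "rels =
     {([Gen Ga, Gen Ga, Gen Ga], []),
      ([Gen Gb, Gen Gb, Gen Gb], []),
      ([Gen Gt, Gen Gt], []),
      ([Gen Ga, Gen Gb], [Gen Gb, Gen Ga]),
      ([Gen Gt, Gen Ga, Gen Gt], [Gen Ga, Gen Ga]),
      ([Gen Gt, Gen Gb, Gen Gt], [Gen Gb, Gen Gb])}"

end

theory Submission
  imports Defs
begin

text \<open>Two vertices \<open>u\<close>, \<open>v\<close> of \<open>Cay(G, \<partial>A)\<close> are adjacent iff \<open>u \<noteq> v\<close> and the translates \<open>Au\<close> and \<open>Av\<close>
  meet, so independent sets \<open>I\<close> are those for which the products \<open>xu\<close> with \<open>x \<in> A\<close>, \<open>u \<in> I\<close> are all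
  distinct. Hence \<open>|A| |I| \<le> |G|\<close>, and for maximal \<open>I\<close> the sets \<open>A\<inverse>Au\<close> with \<open>u \<in> I\<close> cover \<open>G\<close>, so
  \<open>|G| \<le> |A|\<^sup>2 |I|\<close>. With \<open>|G| = 18\<close> and \<open>|A| = 4\<close> this gives \<open>|I| \<le> 4\<close> and \<open>|I| \<ge> 2\<close>. Both bounds
  are attained: by \<open>{e, ab, b\<^sup>2t, abt}\<close> and by the maximal independent set \<open>{e, ab\<^sup>2t}\<close>. To compute
  in \<open>G\<close>, it is identified with the generalized dihedral group over \<open>(\<int>/3)\<^sup>2\<close>.\<close>

section \<open>Independent sets in Cayley graphs of difference sets\<close>

context group
begin

text \<open>Solving \<open>v \<otimes> inv u = inv x \<otimes> y\<close> for a product without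
  inverses gives the form that is later evaluated in a concrete model.\<close>

lemma mult_inv_in_difference_set_iff:
  assumes A: "A \<subseteq> carrier G" and uv: "u \<in> carrier G" "v \<in> carrier G"
  shows "v \<otimes> inv u \<in> difference_set G A \<longleftrightarrow> u \<noteq> v \<and> (\<exists>x\<in>A. \<exists>y\<in>A. x \<otimes> v = y \<otimes> u)"
proof -
  have *: "v \<otimes> inv u = inv x \<otimes> y \<longleftrightarrow> x \<otimes> v = y \<otimes> u" if "x \<in> A" "y \<in> A" for x y
  proof -
    have "x \<in> carrier G" "y \<in> carrier G" using that A by auto
    then show ?thesis using uv
      by (metis inv_closed inv_solve_left inv_solve_right m_assoc m_closed)
  qed
  have "v \<otimes> inv u = \<one> \<longleftrightarrow> u = v"
    using uv by (metis inv_closed inv_equality inv_inv r_inv)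
  then show ?thesis
    using * by (auto simp: difference_set_def set_mult_def SET_INV_def)
qed

lemma independent_set_cayley_difference_set_iff:
  assumes A: "A \<subseteq> carrier G"
  shows "independent_set (cayley_graph G (difference_set G A)) I \<longleftrightarrow>
    I \<subseteq> carrier G \<and> (\<forall>u\<in>I. \<forall>v\<in>I. \<forall>x\<in>A. \<forall>y\<in>A. x \<otimes> v = y \<otimes> u \<longrightarrow> u = v)"
    (is "_ \<longleftrightarrow> _ \<and> ?P")
proof -
  have "indep I (snd (cayley_graph G (difference_set G A))) \<longleftrightarrow> ?P" if I: "I \<subseteq> carrier G"
  proof -
    have "{u, v} \<in> snd (cayley_graph G (difference_set G A)) \<longleftrightarrow>
        (\<exists>x\<in>A. \<exists>y\<in>A. x \<otimes> v = y \<otimes> u)" if "u \<in> I" "v \<in> I" "u \<noteq> v" for u v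
    proof -
      have "u \<in> carrier G" "v \<in> carrier G" using that I by auto
      note * = mult_inv_in_difference_set_iff[OF A this]
        mult_inv_in_difference_set_iff[OF A this(2,1)]
      \<comment> \<open>An unordered edge may arise from either orientation; exchanging
        \<open>x\<close> and \<open>y\<close> shows that both give the same condition.\<close>
      have "{u, v} \<in> snd (cayley_graph G (difference_set G A)) \<longleftrightarrow>
          v \<otimes> inv u \<in> difference_set G A \<or> u \<otimes> inv v \<in> difference_set G A"
        using \<open>u \<in> carrier G\<close> \<open>v \<in> carrier G\<close>
        by (auto simp: cayley_graph_def doubleton_eq_iff)
      then show ?thesis unfolding * using \<open>u \<noteq> v\<close> by metis
    qed
    then show ?thesis unfolding indep_def by metis
  qed
  then show ?thesis by (auto simp: independent_set_def cayley_graph_def)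
qed

text \<open>Packing bound: the translates of \<open>A\<close> by the elements of \<open>I\<close>
  are pairwise disjoint and each has \<open>card A\<close> elements.\<close>

lemma card_independent_set_le:
  assumes fin: "finite (carrier G)" and A: "A \<subseteq> carrier G"
    and I: "independent_set (cayley_graph G (difference_set G A)) I"
  shows "card A * card I \<le> card (carrier G)"
proof -
  have I': "I \<subseteq> carrier G"
    and inj: "\<And>u v x y. u \<in> I \<Longrightarrow> v \<in> I \<Longrightarrow> x \<in> A \<Longrightarrow> y \<in> A \<Longrightarrow> x \<otimes> v = y \<otimes> u \<Longrightarrow> u = v"
    using I independent_set_cayley_difference_set_iff[OF A] by blast+
  have "inj_on (\<lambda>(x, u). x \<otimes> u) (A \<times> I)"
  proof (rule inj_onI, clarify)
    fix x u y v assume h: "x \<in> A" "u \<in> I" "y \<in> A" "v \<in> I" "x \<otimes> u = y \<otimes> v"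
    then have "u = v" using inj by metis
    moreover have "x = y" using h \<open>u = v\<close> A I' r_cancel by blast
    ultimately show "x = y \<and> u = v" by simp
  qed
  moreover have "(\<lambda>(x, u). x \<otimes> u) ` (A \<times> I) \<subseteq> carrier G" using A I' by auto
  ultimately have "card (A \<times> I) \<le> card (carrier G)" using card_inj_on_le fin by blast
  then show ?thesis by (simp add: card_cartesian_product)
qed

text \<open>Maximal means independent and dominating: a vertex whose translate of \<open>A\<close>
  meets none of those from \<open>I\<close> could be added.\<close>

lemma maximal_independent_set_cayley_difference_set_iff:
  assumes A: "A \<subseteq> carrier G" "A \<noteq> {}"
  shows "maximal_independent_set (cayley_graph G (difference_set G A)) I \<longleftrightarrow>
    independent_set (cayley_graph G (difference_set G A)) I \<and>
    (\<forall>w\<in>carrier G. \<exists>u\<in>I. \<exists>x\<in>A. \<exists>y\<in>A. x \<otimes> w = y \<otimes> u)" (is "?M \<longleftrightarrow> ?I I \<and> ?D")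
proof
  note ind = independent_set_cayley_difference_set_iff[OF A(1)]
  assume M: ?M
  then have I: "?I I" and max: "\<And>J. ?I J \<Longrightarrow> I \<subseteq> J \<Longrightarrow> J = I"
    by (auto simp: maximal_independent_set_def)
  moreover have ?D
  proof
    fix w assume w: "w \<in> carrier G"
    show "\<exists>u\<in>I. \<exists>x\<in>A. \<exists>y\<in>A. x \<otimes> w = y \<otimes> u"
    proof (rule ccontr)
      assume no: "\<not> ?thesis"
      then have "?I (insert w I)" using w I unfolding ind by (metis insert_iff insert_subset)
      then have "w \<in> I" using max by blast
      \<comment> \<open>With \<open>u = w\<close>, any \<open>x = y\<close> in the non-empty
        \<open>A\<close> contradicts \<open>no\<close>.\<close>
      then show False using no A(2) by blast
    qed
  qed
  ultimately show "?I I \<and> ?D" by blast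
next
  note ind = independent_set_cayley_difference_set_iff[OF A(1)]
  assume h: "?I I \<and> ?D"
  have "J = I" if J: "?I J" "I \<subseteq> J" for J
  proof
    show "J \<subseteq> I"
    proof
      fix w assume "w \<in> J"
      \<comment> \<open>The dominating \<open>u\<close> lies in \<open>J\<close> too, so
        independence of \<open>J\<close> forces \<open>w = u\<close>.\<close>
      moreover from this obtain u x y where "u \<in> I" "x \<in> A" "y \<in> A" "x \<otimes> w = y \<otimes> u"
        using h J(1) unfolding ind by blast
      ultimately show "w \<in> I" using J unfolding ind by blast
    qed
  qed (use J in blast)
  then show ?M using h unfolding maximal_independent_set_def by blast
qed

lemma card_le_maximal_independent_set:
  assumes fin: "finite (carrier G)" and A: "A \<subseteq> carrier G" "A \<noteq> {}"
    and I: "maximal_independent_set (cayley_graph G (difference_set G A)) I"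
  shows "card (carrier G) \<le> (card A)\<^sup>2 * card I"
proof -
  have I': "I \<subseteq> carrier G"
    and dom: "\<And>w. w \<in> carrier G \<Longrightarrow> \<exists>u\<in>I. \<exists>x\<in>A. \<exists>y\<in>A. x \<otimes> w = y \<otimes> u"
    using I unfolding maximal_independent_set_cayley_difference_set_iff[OF A]
      independent_set_cayley_difference_set_iff[OF A(1)] by blast+
  let ?f = "\<lambda>(x, y, u). inv x \<otimes> (y \<otimes> u)"
  have "carrier G \<subseteq> ?f ` (A \<times> A \<times> I)"
  proof
    fix w assume w: "w \<in> carrier G"
    then obtain u x y where h: "u \<in> I" "x \<in> A" "y \<in> A" "x \<otimes> w = y \<otimes> u"
      using dom by blast
    then have "w = inv x \<otimes> (y \<otimes> u)"
      using A(1) I' w inv_solve_left[of w x "y \<otimes> u"] by (metis m_closed subsetD)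
    then show "w \<in> ?f ` (A \<times> A \<times> I)" using h by (auto intro: image_eqI[of _ _ "(x, y, u)"])
  qed
  moreover have "finite (A \<times> A \<times> I)" using fin A(1) I' by (auto intro: finite_subset)
  ultimately have "card (carrier G) \<le> card (A \<times> A \<times> I)" by (rule surj_card_le[rotated])
  then show ?thesis by (simp add: card_cartesian_product power2_eq_square)
qed

end

section \<open>Generalized dihedral normal forms\<close>

locale dihedral_relations = group +
  fixes a b t
  assumes closed: "a \<in> carrier G" "b \<in> carrier G" "t \<in> carrier G"
    and a3: "a \<otimes> (a \<otimes> a) = \<one>" and b3: "b \<otimes> (b \<otimes> b) = \<one>" and t2: "t \<otimes> t = \<one>"
    and ab: "a \<otimes> b = b \<otimes> a"
    and tat: "t \<otimes> (a \<otimes> t) = a \<otimes> a" and tbt: "t \<otimes> (b \<otimes> t) = b \<otimes> b"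
begin

text \<open>Exponents stay unreduced, so that left multiplication by a generator is plain arithmetic
  on them. Distinct reduced triples may still give equal elements, since the locale does not exclude
  further relations.\<close>

definition nf :: "nat \<Rightarrow> nat \<Rightarrow> nat \<Rightarrow> 'a" where
  "nf m n k = a [^] m \<otimes> (b [^] n \<otimes> t [^] k)"

lemma pow_mod_order:
  fixes n :: nat
  assumes "x \<in> carrier G" "x [^] k = \<one>"
  shows "x [^] n = x [^] (n mod k)"
proof -
  have "x [^] n = x [^] (k * (n div k) + n mod k)" by simp
  also have "\<dots> = (x [^] k) [^] (n div k) \<otimes> x [^] (n mod k)"
    using assms(1) by (simp only: nat_pow_mult nat_pow_pow)
  finally show ?thesis using assms by simp
qed

lemma nf_mod: "nf m n k = nf (m mod 3) (n mod 3) (k mod 2)"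
proof -
  have "a [^] (3::nat) = \<one>" "b [^] (3::nat) = \<one>" "t [^] (2::nat) = \<one>"
    using closed a3 b3 t2 by (simp_all add: numeral_eq_Suc m_assoc)
  then show ?thesis unfolding nf_def using closed pow_mod_order by metis
qed

lemma nf_cong:
  assumes "m mod 3 = m' mod 3" "n mod 3 = n' mod 3" "k mod 2 = k' mod 2"
  shows "nf m n k = nf m' n' k'"
  using assms nf_mod by metis

text \<open>Each factor \<open>x\<close> passed by \<open>t\<close> becomes its square. For
  \<open>x\<close> of order dividing 3 this is inversion, kept within natural exponents.\<close>

lemma conj_t_pow:
  fixes n :: nat
  assumes x: "x \<in> carrier G" and "t \<otimes> (x \<otimes> t) = x \<otimes> x"
  shows "t \<otimes> x [^] n = x [^] (2 * n) \<otimes> t"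
proof (induction n)
  case 0
  then show ?case using closed by simp
next
  case (Suc n)
  have tx: "t \<otimes> x = x \<otimes> (x \<otimes> t)"
  proof -
    have "t \<otimes> x = t \<otimes> (x \<otimes> t) \<otimes> t" using x closed t2 by (simp add: m_assoc)
    then show ?thesis using assms closed by (simp add: m_assoc)
  qed
  have "t \<otimes> x [^] Suc n = (t \<otimes> x [^] n) \<otimes> x" using x closed by (simp add: m_assoc)
  also have "\<dots> = x [^] (2 * n) \<otimes> (t \<otimes> x)" using Suc x closed by (simp add: m_assoc)
  also have "\<dots> = x [^] (2 * Suc n) \<otimes> t" using x closed by (simp add: tx m_assoc)
  finally show ?case .
qed

lemma a_nf: "a \<otimes> nf m n k = nf (Suc m) n k"
  unfolding nf_def using closed nat_pow_Suc2[of a m] by (simp add: m_assoc)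

lemma b_nf: "b \<otimes> nf m n k = nf m (Suc n) k"
proof -
  have "b \<otimes> a [^] m = a [^] m \<otimes> b"
    using closed ab by (simp add: group_commutes_pow)
  then have "b \<otimes> nf m n k = a [^] m \<otimes> (b \<otimes> (b [^] n \<otimes> t [^] k))"
    unfolding nf_def using closed by (metis m_assoc m_closed nat_pow_closed)
  then show ?thesis
    unfolding nf_def using closed nat_pow_Suc2[of b n] by (simp add: m_assoc)
qed

lemma t_nf: "t \<otimes> nf m n k = nf (2 * m) (2 * n) (Suc k)"
proof -
  have "t \<otimes> nf m n k = (t \<otimes> a [^] m) \<otimes> (b [^] n \<otimes> t [^] k)"
    unfolding nf_def using closed by (simp add: m_assoc)
  also have "\<dots> = a [^] (2 * m) \<otimes> ((t \<otimes> b [^] n) \<otimes> t [^] k)"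
    using closed conj_t_pow[OF closed(1) tat] by (simp add: m_assoc)
  also have "\<dots> = nf (2 * m) (2 * n) (Suc k)"
    unfolding nf_def using closed conj_t_pow[OF closed(2) tbt] nat_pow_Suc2[of t k]
    by (simp add: m_assoc)
  finally show ?thesis .
qed

end

section \<open>The group of order 18\<close>

text \<open>The triple \<open>(i, j, k)\<close> stands for \<open>a\<^sup>i b\<^sup>j\<close>, followed by \<open>t\<close> if \<open>k\<close> holds.\<close>

type_synonym dih = "int \<times> int \<times> bool"

definition dih_carrier :: "dih set" where
  "dih_carrier = {0, 1, 2} \<times> {0, 1, 2} \<times> {False, True}"

text \<open>Semidirect product of (Z/3)^2 by Z/2 acting by inversion: moving \<open>t\<close> past
  the second factor flips the signs of its exponents.\<close>

fun dih_mult :: "dih \<Rightarrow> dih \<Rightarrow> dih" where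
  "dih_mult (i, j, k) (i', j', k') =
    ((if k then i - i' else i + i') mod 3, (if k then j - j' else j + j') mod 3, k \<noteq> k')"

fun letter_val :: "gens letter \<Rightarrow> dih" where
  "letter_val (Gen Ga) = (1, 0, False)"
| "letter_val (Inv Ga) = (2, 0, False)"
| "letter_val (Gen Gb) = (0, 1, False)"
| "letter_val (Inv Gb) = (0, 2, False)"
| "letter_val (Gen Gt) = (0, 0, True)"
| "letter_val (Inv Gt) = (0, 0, True)"

definition word_val :: "gens word \<Rightarrow> dih" where
  "word_val w = foldr (\<lambda>x. dih_mult (letter_val x)) w (0, 0, False)"

lemma dih_mult_assoc: "dih_mult (dih_mult p q) r = dih_mult p (dih_mult q r)"
proof -
  obtain i j k i' j' k' i'' j'' k'' where "p = (i, j, k)" "q = (i', j', k')" "r = (i'', j'', k'')"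
    by (metis prod_cases3)
  then show ?thesis
    by (cases k; cases k'; cases k'') 
      (simp_all add: mod_simps add.assoc diff_diff_eq diff_diff_eq2 add_diff_eq diff_add_eq)
qed

lemma dih_mult_in_carrier: "dih_mult p q \<in> dih_carrier"
proof -
  have *: "x mod 3 \<in> {0, 1, 2}" for x :: int by auto
  obtain i j k i' j' k' where "p = (i, j, k)" "q = (i', j', k')" by (metis prod_cases3)
  then show ?thesis
    by (simp only: dih_carrier_def dih_mult.simps) (intro SigmaI *, auto)
qed

lemma dih_mult_one_left: "p \<in> dih_carrier \<Longrightarrow> dih_mult (0, 0, False) p = p"
  by (auto simp: dih_carrier_def)

lemma word_val_Nil [simp]: "word_val [] = (0, 0, False)"
  and word_val_Cons: "word_val (x # w) = dih_mult (letter_val x) (word_val w)"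
  by (simp_all add: word_val_def)

lemma word_val_in_carrier: "word_val w \<in> dih_carrier"
  by (cases w) (simp_all add: word_val_Cons dih_mult_in_carrier, simp add: dih_carrier_def)

lemma word_val_append: "word_val (u @ w) = dih_mult (word_val u) (word_val w)"
  by (induction u)
    (simp_all add: word_val_Cons dih_mult_assoc dih_mult_one_left word_val_in_carrier)

text \<open>The defining relations and free cancellation hold in the model, so evaluation descends
  to the presented group.\<close>

lemma word_val_cong: "pres_eq rels u w \<Longrightarrow> word_val u = word_val w"
proof (induction rule: pres_eq.induct)
  case (cancel p x q)
  have "word_val [x, inv_letter x] = word_val []"
    by (cases x rule: letter_val.cases) (simp_all add: word_val_Cons)
  then show ?case
    using word_val_append[of "[x, inv_letter x]" q] word_val_in_carrier[of q]
    by (simp only: word_val_append word_val_Nil dih_mult_one_left)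
next
  case (rel l r p q)
  then have "word_val l = word_val r" by (auto simp: rels_def word_val_Cons)
  then show ?case by (simp only: word_val_append)
qed simp_all

section \<open>Evaluation and normal forms in the presented group\<close>

interpretation P: group "presented_group rels"
  by (rule group_presented_group)

text \<open>Outside \<open>presented_group rels\<close> the value \<open>class_val c\<close> is junk.\<close>

definition class_val :: "gens word set \<Rightarrow> dih" where
  "class_val c = the_elem (word_val ` c)"

lemma class_val_word_class: "class_val (word_class rels w) = word_val w"
proof -
  have "word_val ` word_class rels w = {word_val w}"
    using word_val_cong by (force simp: in_word_class_iff intro: pres_eq.refl)
  then show ?thesis by (simp add: class_val_def)
qed

lemma class_val_mult:
  assumes "c \<in> carrier (presented_group rels)" "d \<in> carrier (presented_group rels)"
  shows "class_val (c \<otimes>\<^bsub>presented_group rels\<^esub> d) = dih_mult (class_val c) (class_val d)"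
  using assms by (auto simp: carrier_presented_group mult_presented_group class_val_word_class
      word_val_append)

lemma class_val_one: "class_val \<one>\<^bsub>presented_group rels\<^esub> = (0, 0, False)"
  by (simp add: one_presented_group class_val_word_class)

lemma class_val_pres_gen: "class_val (pres_gen rels x) = letter_val (Gen x)"
  by (cases x) (simp_all add: pres_gen_def class_val_word_class word_val_Cons)

lemma pres_gen_closed: "pres_gen rels x \<in> carrier (presented_group rels)"
  by (simp add: pres_gen_def carrier_presented_group)

lemma word_class_Cons_Inv:
  "word_class R (Inv x # w) = inv\<^bsub>presented_group R\<^esub> (pres_gen R x)
    \<otimes>\<^bsub>presented_group R\<^esub> word_class R w"
proof -
  interpret group "presented_group R" by (rule group_presented_group)
  have "word_class R [Inv x] \<otimes>\<^bsub>presented_group R\<^esub> pres_gen R x = \<one>\<^bsub>presented_group R\<^esub>"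
    using pres_eq.cancel[of R "[]" "Inv x" "[]"]
    by (simp add: pres_gen_def mult_presented_group one_presented_group word_class_eq_iff)
  then have "inv\<^bsub>presented_group R\<^esub> (pres_gen R x) = word_class R [Inv x]"
    by (intro inv_equality) (simp_all add: pres_gen_def carrier_presented_group)
  then show ?thesis by (simp add: mult_presented_group)
qed

lemma word_class_Cons_Gen:
  "word_class R (Gen x # w) = pres_gen R x \<otimes>\<^bsub>presented_group R\<^esub> word_class R w"
  by (simp add: pres_gen_def mult_presented_group)

lemma word_class_rel: "(l, r) \<in> R \<Longrightarrow> word_class R l = word_class R r"
  using pres_eq.rel[of l r R "[]" "[]"] by (simp add: word_class_eq_iff)

interpretation D: dihedral_relations "presented_group rels" "pres_gen rels Ga" "pres_gen rels Gb"
  "pres_gen rels Gt"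
proof unfold_locales
  show "pres_gen rels Ga \<in> carrier (presented_group rels)"
    "pres_gen rels Gb \<in> carrier (presented_group rels)"
    "pres_gen rels Gt \<in> carrier (presented_group rels)"
    by (rule pres_gen_closed)+
qed (unfold pres_gen_def mult_presented_group one_presented_group,
    (rule word_class_rel, simp add: rels_def)+)

text \<open>Letters are absorbed from the left, one at a time, into the normal form of the remaining
  word.\<close>

lemma word_class_nf: "\<exists>m n k. word_class rels w = D.nf m n k"
proof (induction w)
  case Nil
  have "word_class rels [] = D.nf 0 0 0"
    by (simp add: D.nf_def flip: one_presented_group)
  then show ?case by blast
next
  case (Cons x w)
  then obtain m n k where w: "word_class rels w = D.nf m n k" by blast
  have nf_closed: "D.nf m n k \<in> carrier (presented_group rels)" for m n k
    by (simp add: D.nf_def pres_gen_closed)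
  \<comment> \<open>For an inverse letter it suffices to find a normal form that the generator
    itself carries to the given one.\<close>
  have inv: "inv\<^bsub>presented_group rels\<^esub> (pres_gen rels y) \<otimes>\<^bsub>presented_group rels\<^esub> D.nf m n k
      = D.nf m' n' k'"
    if "pres_gen rels y \<otimes>\<^bsub>presented_group rels\<^esub> D.nf m' n' k' = D.nf m n k" for y m' n' k'
    using P.inv_solve_left'[OF nf_closed[of m' n' k'] pres_gen_closed[of y] nf_closed[of m n k]]
      that by simp
  show ?case
  proof (cases x rule: letter_val.cases)
    case 2
    \<comment> \<open>Adding 2 serves as subtracting 1 modulo 3.\<close>
    have "D.nf (Suc (m + 2)) n k = D.nf m n k"
      by (rule D.nf_cong) presburger+
    then show ?thesis using 2 w inv[of Ga "m + 2" n k] D.a_nf[of "m + 2" n k]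
      by (auto simp: word_class_Cons_Inv)
  next
    case 4
    have "D.nf m (Suc (n + 2)) k = D.nf m n k"
      by (rule D.nf_cong) presburger+
    then show ?thesis using 4 w inv[of Gb m "n + 2" k] D.b_nf[of m "n + 2" k]
      by (auto simp: word_class_Cons_Inv)
  next
    case 6
    \<comment> \<open>Doubling is its own inverse modulo 3, because 4 is 1 modulo 3.\<close>
    have "D.nf (2 * (2 * m)) (2 * (2 * n)) (Suc (Suc k)) = D.nf m n k"
      by (rule D.nf_cong) presburger+
    then show ?thesis using 6 w inv[of Gt "2 * m" "2 * n" "Suc k"] D.t_nf[of "2 * m" "2 * n" "Suc k"]
      by (auto simp: word_class_Cons_Inv)
  qed (use w in \<open>auto simp: word_class_Cons_Gen D.a_nf D.b_nf D.t_nf\<close>)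
qed

section \<open>The order of the group and its identification with the model\<close>

lemma carrier_nf:
  "carrier (presented_group rels) \<subseteq>
    (\<lambda>(m, n, k). D.nf m n k) ` ({..<3} \<times> {..<3} \<times> {..<2})" (is "_ \<subseteq> ?f ` ?N")
proof
  fix c assume "c \<in> carrier (presented_group rels)"
  then obtain w where "c = word_class rels w" by (auto simp: carrier_presented_group)
  then obtain m n k where "c = D.nf m n k" using word_class_nf by blast
  then have "c = ?f (m mod 3, n mod 3, k mod 2)" by (simp flip: D.nf_mod)
  then show "c \<in> ?f ` ?N" by (rule image_eqI) simp
qed

lemma finite_carrier_rels: "finite (carrier (presented_group rels))"
  by (rule finite_subset[OF carrier_nf]) simp

lemma card_carrier_rels_le: "card (carrier (presented_group rels)) \<le> 18"
  using surj_card_le[OF _ carrier_nf] by (simp add: card_cartesian_product)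

text \<open>Surjectivity supplies the lower bound 18 on the order, complementing the count of normal
  forms.\<close>

lemma class_val_image: "class_val ` carrier (presented_group rels) = dih_carrier"
proof
  show "class_val ` carrier (presented_group rels) \<subseteq> dih_carrier"
    by (auto simp: carrier_presented_group class_val_word_class word_val_in_carrier)
  have "\<exists>w. p = word_val w" if "p \<in> dih_carrier" for p
  proof -
    obtain i j k where p: "p = (i, j, k)" by (cases p)
    then have "p = word_val (replicate (nat i) (Gen Ga) @ replicate (nat j) (Gen Gb)
        @ (if k then [Gen Gt] else []))"
      using that by (auto simp: dih_carrier_def word_val_Cons numeral_2_eq_2)
    then show ?thesis by blast
  qed
  then show "dih_carrier \<subseteq> class_val ` carrier (presented_group rels)"
    by (force simp: carrier_presented_group class_val_word_class image_iff)
qed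

lemma card_dih_carrier: "card dih_carrier = 18"
  by (simp add: dih_carrier_def card_cartesian_product)

lemma card_carrier_rels: "card (carrier (presented_group rels)) = 18"
  using card_carrier_rels_le card_image_le[OF finite_carrier_rels, of class_val]
  by (simp add: class_val_image card_dih_carrier)

text \<open>A surjection between finite sets of equal size is injective; equality in the group can
  thus be decided by computing in the model.\<close>

lemma inj_on_class_val: "inj_on class_val (carrier (presented_group rels))"
  by (rule eq_card_imp_inj_on)
    (simp_all add: finite_carrier_rels class_val_image card_dih_carrier card_carrier_rels)

section \<open>The two graph parameters\<close>

theorem lemma14:
  fixes G :: "gens word set monoid" and a b t :: "gens word set" and A :: "gens word set set"
  assumes "G = presented_group rels"
    and "a = pres_gen rels Ga" and "b = pres_gen rels Gb" and "t = pres_gen rels Gt"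
    and "A = {\<one>\<^bsub>G\<^esub>, a, t, b \<otimes>\<^bsub>G\<^esub> t}"
  shows "independent_domination_number (cayley_graph G (difference_set G A)) = 2
       \<and> independence_number (cayley_graph G (difference_set G A)) = 4"
proof -
  interpret group G unfolding assms(1) by (rule group_presented_group)
  let ?\<Gamma> = "cayley_graph G (difference_set G A)"
  have closed [simp]: "a \<in> carrier G" "b \<in> carrier G" "t \<in> carrier G"
    using assms pres_gen_closed by simp_all
  have val: "class_val \<one>\<^bsub>G\<^esub> = (0, 0, False)" "class_val a = (1, 0, False)"
    "class_val b = (0, 1, False)" "class_val t = (0, 0, True)"
    "\<And>c d. c \<in> carrier G \<Longrightarrow> d \<in> carrier G \<Longrightarrow>
      class_val (c \<otimes>\<^bsub>G\<^esub> d) = dih_mult (class_val c) (class_val d)"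
    using assms by (simp_all add: class_val_one class_val_pres_gen class_val_mult)
  have eq_iff: "c = d \<longleftrightarrow> class_val c = class_val d" if "c \<in> carrier G" "d \<in> carrier G" for c d
    using that inj_on_class_val assms(1) by (auto dest: inj_onD)
  have fin: "finite (carrier G)" and card_G: "card (carrier G) = 18"
    using finite_carrier_rels card_carrier_rels assms(1) by simp_all
  have A: "A \<subseteq> carrier G" "A \<noteq> {}" using assms(5) by simp_all
  have card_A: "card A = 4" unfolding assms(5) by (simp add: eq_iff val)
  note ind = independent_set_cayley_difference_set_iff[OF A(1)]
  note max = maximal_independent_set_cayley_difference_set_iff[OF A]
  have upper: "card I \<le> 4" if "independent_set ?\<Gamma> I" for I
    using card_independent_set_le[OF fin A(1) that] card_A card_G by simp
  have lower: "2 \<le> card I" if "maximal_independent_set ?\<Gamma> I" for I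
    using card_le_maximal_independent_set[OF fin A that] card_A card_G by simp

  \<comment> \<open>The four translates of \<open>A\<close> fill 16 of the 18 elements, missing only
    ab^2 and at.\<close>
  define I where "I = {\<one>\<^bsub>G\<^esub>, a \<otimes>\<^bsub>G\<^esub> b, b \<otimes>\<^bsub>G\<^esub> (b \<otimes>\<^bsub>G\<^esub> t), a \<otimes>\<^bsub>G\<^esub> (b \<otimes>\<^bsub>G\<^esub> t)}"
  have I: "independent_set ?\<Gamma> I" "card I = 4"
    unfolding ind unfolding I_def assms(5) by (simp_all add: eq_iff val)
  have \<alpha>: "independence_number ?\<Gamma> = 4"
    unfolding independence_number_def
  proof (rule Max_eqI)
    show "finite {card I |I. independent_set ?\<Gamma> I}"
      by (rule finite_subset[of _ "{..4}"]) (auto dest: upper)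
    show "4 \<in> {card I |I. independent_set ?\<Gamma> I}"
      using I by (intro CollectI exI[of _ I]) simp
  qed (auto dest: upper)

  \<comment> \<open>Here A^-1 A has 9 elements and is disjoint from its right translate by ab^2t, so
    the two together partition \<open>G\<close>.\<close>
  define M where "M = {\<one>\<^bsub>G\<^esub>, a \<otimes>\<^bsub>G\<^esub> (b \<otimes>\<^bsub>G\<^esub> (b \<otimes>\<^bsub>G\<^esub> t))}"
  have "independent_set ?\<Gamma> M" "card M = 2"
    unfolding ind unfolding M_def assms(5) by (simp_all add: eq_iff val)
  moreover have "\<exists>u\<in>M. \<exists>x\<in>A. \<exists>y\<in>A. x \<otimes>\<^bsub>G\<^esub> w = y \<otimes>\<^bsub>G\<^esub> u" if w: "w \<in> carrier G" for w
  proof -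
    \<comment> \<open>Domination reduces to 18 cases, one for each possible value of
      \<open>w\<close> in the model.\<close>
    have "class_val w \<in> dih_carrier" using w class_val_image assms(1) by blast
    then show ?thesis
      using w unfolding M_def assms(5) dih_carrier_def
      by (elim SigmaE insertE emptyE) (simp_all add: eq_iff val)
  qed
  ultimately have M: "maximal_independent_set ?\<Gamma> M" "card M = 2" unfolding max by blast+
  have "independent_domination_number ?\<Gamma> = 2"
    unfolding independent_domination_number_def
  proof (rule Min_eqI)
    show "finite {card I |I. maximal_independent_set ?\<Gamma> I}"
      by (rule finite_subset[of _ "{..4}"]) (auto simp: maximal_independent_set_def dest: upper)
    show "2 \<in> {card I |I. maximal_independent_set ?\<Gamma> I}"
      using M by (intro CollectI exI[of _ M]) simp
  qed (auto dest: lower)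
  with \<alpha> show ?thesis by simp
qed

end
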